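(* Let $X\subset\mathbb{R}^m$, $Y\subset\mathbb{R}^n$ be two nonempty compact convex sets. Let $f\in\mathcal{C}^1(Y\times X)$ be convex on $Y\times X$. Let $(\mathcal{Q}^k)_{k\ge1}$ be a sequence of convex $L$-Lipschitz continuous functions on $Y$ satisfying $\underline{\mathcal{Q}}\le\mathcal{Q}^k\le\bar{\mathcal{Q}}$ on $Y$, where $\underline{\mathcal{Q}},\bar{\mathcal{Q}}$ are continuous on $Y$. Let $(x^k)_{k\ge1}$ be a sequence in $X$, $(\varepsilon^k)_{k\ge1}$ a sequence of nonnegative real numbers, and let $y^k(\varepsilon^k)\in Y$ be an $\varepsilon^k$-optimal solution of $$\inf\{f(y,x^k)+\mathcal{Q}^k(y):y\in Y\}.$$ Define $$\eta^k(\varepsilon^k)=\max_{y\in Y}\ \langle\nabla_yf(y^k(\varepsilon^k),x^k),y^k(\varepsilon^k)-y\rangle+\mathcal{Q}^k(y^k(\varepsilon^k))-\mathcal{Q}^k(y).$$ Then if $\lim_{k\to+\infty}\varepsilon^k=0$ we have $\lim_{k\to+\infty}\eta^k(\varepsilon^k)=0$.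
   Context: $\mathcal{C}^1(Y\times X)$ is the set of real-valued continuously differentiable functions on $Y\times X$. An $\varepsilon$-optimal solution is a feasible point whose objective value is at most the optimal value plus $\varepsilon$. *)

theory Defs
  imports "HOL-Analysis.Analysis"
begin

text \<open>
  Derivatives are taken relative to the set, since the sets considered here are closed and may have
  empty interior. At an interior point this is the usual gradient, and at any point the usual
  gradient, if it exists, is also a gradient relative to the set (lemma below).
\<close>

definition has_gradient_within ::
    "('a::euclidean_space \<Rightarrow> real) \<Rightarrow> 'a \<Rightarrow> 'a \<Rightarrow> 'a set \<Rightarrow> bool" where
  "has_gradient_within f g z S \<longleftrightarrow> (f has_derivative (\<lambda>h. g \<bullet> h)) (at z within S)"

definition C1_on :: "'a::euclidean_space set \<Rightarrow> ('a \<Rightarrow> real) \<Rightarrow> bool" where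
  "C1_on S f \<longleftrightarrow>
     (\<exists>G. continuous_on S G \<and> (\<forall>z\<in>S. has_gradient_within f (G z) z S))"

definition partial_gradient_fst_on ::
    "'a::euclidean_space set \<Rightarrow> 'b::euclidean_space set \<Rightarrow> ('a \<times> 'b \<Rightarrow> real) \<Rightarrow> ('a \<times> 'b \<Rightarrow> 'a) \<Rightarrow> bool"
  where
  "partial_gradient_fst_on Y X f g \<longleftrightarrow>
     (\<forall>y\<in>Y. \<forall>x\<in>X. has_gradient_within (\<lambda>u. f (u, x)) (g (y, x)) y Y)"

definition eps_optimal :: "('a \<Rightarrow> real) \<Rightarrow> 'a set \<Rightarrow> real \<Rightarrow> 'a \<Rightarrow> bool" where
  "eps_optimal F Y e y \<longleftrightarrow> y \<in> Y \<and> F y \<le> (INF z\<in>Y. F z) + e"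

text \<open>
  \<open>maximum_on F Y\<close> is \<open>max {F y | y \<in> Y}\<close>; the library's \<open>Max\<close> is only meaningful for finite sets.
\<close>

definition maximum_on :: "('a \<Rightarrow> real) \<Rightarrow> 'a set \<Rightarrow> real" where
  "maximum_on F Y = (GREATEST v. v \<in> F ` Y)"

text \<open>
  Here \<open>g\<close> stands for \<open>\<nabla>\<^sub>y f\<close> and \<open>yk\<close>, \<open>xk\<close>, \<open>Qk\<close> for the \<open>k\<close>-th terms of the respective sequences.
\<close>

definition eta ::
    "('a::euclidean_space \<times> 'b \<Rightarrow> 'a) \<Rightarrow> ('a \<Rightarrow> real) \<Rightarrow> 'a set \<Rightarrow> 'b \<Rightarrow> 'a \<Rightarrow> real" where
  "eta g Qk Y xk yk = maximum_on (\<lambda>y. g (yk, xk) \<bullet> (yk - y) + Qk yk - Qk y) Y"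

lemma GDERIV_imp_has_gradient_within:
  assumes "GDERIV f z :> g"
  shows "has_gradient_within f g z S"
  using assms unfolding has_gradient_within_def gderiv_def
  by (simp add: inner_commute[of _ g] has_derivative_at_withinI)

lemma C1_on_imp_partial_gradient_fst_on:
  assumes "C1_on (Y \<times> X) f"
  obtains g where "partial_gradient_fst_on Y X f g"
proof -
  obtain G where G: "\<And>z. z \<in> Y \<times> X \<Longrightarrow> (f has_derivative (\<lambda>h. G z \<bullet> h)) (at z within Y \<times> X)"
    using assms unfolding C1_on_def has_gradient_within_def by blast
  have "((\<lambda>u. f (u, x)) has_derivative (\<lambda>h. fst (G (y, x)) \<bullet> h)) (at y within Y)"
    if "y \<in> Y" "x \<in> X" for y x
  proof -
    have p: "((\<lambda>u. (u, x)) has_derivative (\<lambda>h. (h, 0))) (at y within Y)"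
      by (auto intro!: derivative_eq_intros)
    have "((\<lambda>u. f (u, x)) has_derivative (\<lambda>h. G (y, x) \<bullet> (h, 0))) (at y within Y)"
      by (rule has_derivative_in_compose2[OF G _ _ p]) (use that in auto)
    then show ?thesis
      by (simp add: inner_prod_def)
  qed
  then show thesis
    by (intro that[of "\<lambda>z. fst (G z)"])
      (simp add: partial_gradient_fst_on_def has_gradient_within_def)
qed

text \<open>
  If the interior is empty, gradients relative to the set are not unique, but their values on
  directions within a convex set are. Hence \<open>eta\<close> does not depend on the choice of \<open>g\<close>.
\<close>

lemma has_gradient_within_inner_unique:
  assumes "convex S" "y \<in> S" "z \<in> S"
    and g1: "has_gradient_within f g1 y S" and g2: "has_gradient_within f g2 y S"
  shows "g1 \<bullet> (y - z) = g2 \<bullet> (y - z)"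
proof -
  let ?p = "\<lambda>t::real. y + t *\<^sub>R (z - y)"
  have pS: "?p ` {0..1} \<subseteq> S"
    using convexD_alt[OF \<open>convex S\<close> \<open>y \<in> S\<close> \<open>z \<in> S\<close>] by (auto simp: algebra_simps)
  have v: "((\<lambda>t. f (?p t)) has_vector_derivative (g \<bullet> (z - y))) (at 0 within {0..1})"
    if "has_gradient_within f g y S" for g
  proof -
    have p: "(?p has_derivative (\<lambda>t. t *\<^sub>R (z - y))) (at 0 within {0..1})"
      by (auto intro!: derivative_eq_intros)
    have "(f has_derivative (\<lambda>h. g \<bullet> h)) (at (?p 0) within ?p ` {0..1})"
      using that has_derivative_subset[OF _ pS] by (simp add: has_gradient_within_def)
    from has_derivative_in_compose[OF p this] show ?thesis
      by (simp add: has_vector_derivative_def)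
  qed
  have "g1 \<bullet> (z - y) = g2 \<bullet> (z - y)"
    using vector_derivative_unique_within_closed_interval[OF _ _ v[OF g1, folded box_real] v[OF g2, folded box_real]]
    by simp
  then show ?thesis
    by (simp add: inner_diff_right)
qed

end

theory Submission imports Defs begin

text \<open>
  Moving from the \<open>\<epsilon>\<close>-optimal point \<open>y\<close> a fraction \<open>t\<close> of the way towards \<open>u \<in> Y\<close> lowers the objective
  by at most \<open>\<epsilon>\<close>. On the other hand, convexity of \<open>q\<close> and linearization of \<open>\<phi> = f(\<cdot>, x)\<close> at \<open>y\<close> show
  that this move lowers it by at least \<open>t\<close> times the gap
  \<open>\<nabla>\<phi>(y) \<bullet> (y - u) + q y - q u\<close>, minus a remainder \<open>t \<cdot> r\<close>. So the gap is at most \<open>\<epsilon> / t + r\<close>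
  (lemma \<open>linearized_gap_le\<close>). Because \<open>f\<close> is \<open>C\<^sup>1\<close> on a compact convex set, the
  remainder \<open>r\<close> tends to \<open>0\<close> with \<open>t\<close> uniformly in \<open>y\<close>, \<open>u\<close> and \<open>x\<close>
  (lemma \<open>C1_on_uniform_linearization\<close>), so a single \<open>t\<close> serves for all \<open>k\<close>: first \<open>t\<close> is fixed to make
  \<open>r\<close> small, then \<open>k\<close> is taken large to make \<open>\<epsilon>\<^sup>k / t\<close> small. The reverse inequality
  \<open>\<eta>\<^sup>k \<ge> 0\<close> is the choice \<open>u = y\<close>.
\<close>

text \<open>
  The gradient is uniformly continuous by compactness; bounding the derivative of the difference between
  \<open>f\<close> and its linearization at \<open>z\<close> along the segment from \<open>z\<close> to \<open>w\<close> gives the claim.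
\<close>

lemma C1_on_uniform_linearization:
  fixes S :: "'a::euclidean_space set"
  assumes "compact S" "convex S" "continuous_on S G"
    and grad: "\<And>z. z \<in> S \<Longrightarrow> has_gradient_within f (G z) z S"
    and "e > 0"
  obtains d where "d > 0"
    "\<And>z w. \<lbrakk>z \<in> S; w \<in> S; dist z w < d\<rbrakk> \<Longrightarrow> \<bar>f w - f z - G z \<bullet> (w - z)\<bar> \<le> e * norm (w - z)"
proof -
  have "uniformly_continuous_on S G"
    using assms compact_uniformly_continuous by blast
  then obtain d where d: "d > 0" "\<And>z w. \<lbrakk>z \<in> S; w \<in> S; dist w z < d\<rbrakk> \<Longrightarrow> dist (G w) (G z) < e"
    using \<open>e > 0\<close> unfolding uniformly_continuous_on_def by meson
  have "\<bar>f w - f z - G z \<bullet> (w - z)\<bar> \<le> e * norm (w - z)"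
    if zw: "z \<in> S" "w \<in> S" "dist z w < d" for z w
  proof -
    let ?T = "S \<inter> ball z d"
    have "convex ?T" "z \<in> ?T" "w \<in> ?T"
      using \<open>convex S\<close> zw \<open>d > 0\<close> by (auto simp: convex_Int)
    have seg: "z + t *\<^sub>R (w - z) \<in> ?T" if "t \<in> {0..1}" for t
      using convexD_alt[OF \<open>convex ?T\<close> \<open>z \<in> ?T\<close> \<open>w \<in> ?T\<close>, of t] that
      by (simp add: algebra_simps)
    have der: "(f has_derivative (\<lambda>h. G v \<bullet> h)) (at v within ?T)" if "v \<in> ?T" for v
      using grad[of v] that has_derivative_subset[of f _ v S ?T]
      by (auto simp: has_gradient_within_def)
    have "onorm ((\<bullet>) (G v) - (\<bullet>) (G z)) \<le> e" if "v \<in> ?T" for v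
    proof (rule onorm_le)
      fix h
      have "norm (((\<bullet>) (G v) - (\<bullet>) (G z)) h) \<le> norm (G v - G z) * norm h"
        by (simp add: Cauchy_Schwarz_ineq2 flip: inner_diff_left)
      also have "\<dots> \<le> e * norm h"
        using d(2)[of z v] zw that
        by (intro mult_right_mono) (auto simp: dist_norm norm_minus_commute)
      finally show "norm (((\<bullet>) (G v) - (\<bullet>) (G z)) h) \<le> e * norm h" .
    qed
    from differentiable_bound_linearization[OF seg der this \<open>z \<in> ?T\<close>]
    show ?thesis by (simp add: mult.commute)
  qed
  with d(1) show thesis by (rule that)
qed

lemma has_gradient_within_fst:
  assumes "has_gradient_within f G (y, x) (Y \<times> X)" "x \<in> X"
  shows "has_gradient_within (\<lambda>u. f (u, x)) (fst G) y Y"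
proof -
  have p: "((\<lambda>u. (u, x)) has_derivative (\<lambda>h. (h, 0))) (at y within Y)"
    by (auto intro!: derivative_eq_intros)
  have "(f has_derivative (\<lambda>h. G \<bullet> h)) (at (y, x) within (\<lambda>u. (u, x)) ` Y)"
    using assms unfolding has_gradient_within_def by (auto elim: has_derivative_subset)
  from has_derivative_in_compose[OF p this] show ?thesis
    by (simp add: has_gradient_within_def inner_prod_def)
qed

lemma maximum_on_attained:
  assumes "compact Y" "Y \<noteq> {}" "continuous_on Y F"
  obtains u where "u \<in> Y" "maximum_on F Y = F u" "\<And>v. v \<in> Y \<Longrightarrow> F v \<le> F u"
proof -
  obtain u where u: "u \<in> Y" "\<forall>v\<in>Y. F v \<le> F u"
    using continuous_attains_sup[OF assms] by blast
  then have "maximum_on F Y = F u"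
    unfolding maximum_on_def by (intro Greatest_equality) auto
  with u show thesis by (intro that) auto
qed

text \<open>
  The candidate that is compared with \<open>y\<close> is \<open>y + t (u - y)\<close>. Both the linear term and the bound
  \<open>q (y + t (u - y)) - q y \<le> t (q u - q y)\<close> scale with \<open>t\<close>; only \<open>e\<close> does not, hence the quotient
  \<open>e / t\<close>.
\<close>

lemma linearized_gap_le:
  fixes Y :: "'a::euclidean_space set"
  assumes "convex Y" "convex_on Y q" and bdd: "bdd_below ((\<lambda>u. \<phi> u + q u) ` Y)"
    and opt: "eps_optimal (\<lambda>u. \<phi> u + q u) Y e y"
    and "u \<in> Y" and t: "0 < t" "t \<le> 1"
    and lin: "\<phi> (y + t *\<^sub>R (u - y)) \<le> \<phi> y + t * (a \<bullet> (u - y)) + t * r"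
  shows "a \<bullet> (y - u) + q y - q u \<le> e / t + r"
proof -
  let ?z = "y + t *\<^sub>R (u - y)"
  have "y \<in> Y" using opt by (simp add: eps_optimal_def)
  have z: "?z = (1 - t) *\<^sub>R y + t *\<^sub>R u" by (simp add: algebra_simps)
  have "?z \<in> Y"
    unfolding z using convexD_alt[OF \<open>convex Y\<close> \<open>y \<in> Y\<close> \<open>u \<in> Y\<close>] t by simp
  have "\<phi> y + q y \<le> (INF v\<in>Y. \<phi> v + q v) + e"
    using opt by (simp add: eps_optimal_def)
  also have "(INF v\<in>Y. \<phi> v + q v) \<le> \<phi> ?z + q ?z"
    using bdd \<open>?z \<in> Y\<close> by (rule cINF_lower)
  finally have 1: "\<phi> y + q y \<le> \<phi> ?z + q ?z + e" by simp
  have 2: "q ?z \<le> (1 - t) * q y + t * q u"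
    unfolding z using convex_onD[OF \<open>convex_on Y q\<close>] t \<open>y \<in> Y\<close> \<open>u \<in> Y\<close> by simp
  have "t * (a \<bullet> (y - u) + q y - q u) \<le> e + t * r"
    using 1 2 lin by (simp add: algebra_simps inner_diff_right)
  then show ?thesis
    using t by (simp add: field_simps)
qed

theorem proposition4p5:
  fixes X :: "(real ^ 'm) set" and Y :: "(real ^ 'n) set"
    and f :: "(real ^ 'n) \<times> (real ^ 'm) \<Rightarrow> real"
    and grad_y_f :: "(real ^ 'n) \<times> (real ^ 'm) \<Rightarrow> real ^ 'n"
    and Q :: "nat \<Rightarrow> real ^ 'n \<Rightarrow> real" and Qlow Qup :: "real ^ 'n \<Rightarrow> real"
    and L :: real
    and x :: "nat \<Rightarrow> real ^ 'm" and y :: "nat \<Rightarrow> real ^ 'n" and \<epsilon> :: "nat \<Rightarrow> real"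
  assumes "X \<noteq> {}" "compact X" "convex X"
    and "Y \<noteq> {}" "compact Y" "convex Y"
    and "C1_on (Y \<times> X) f" "convex_on (Y \<times> X) f"
    and "partial_gradient_fst_on Y X f grad_y_f"
    and "\<And>k. k \<ge> 1 \<Longrightarrow> convex_on Y (Q k)"
    and "\<And>k. k \<ge> 1 \<Longrightarrow> L-lipschitz_on Y (Q k)"
    and "continuous_on Y Qlow" "continuous_on Y Qup"
    and "\<And>k u. k \<ge> 1 \<Longrightarrow> u \<in> Y \<Longrightarrow> Qlow u \<le> Q k u \<and> Q k u \<le> Qup u"
    and "\<And>k. k \<ge> 1 \<Longrightarrow> x k \<in> X"
    and "\<And>k. k \<ge> 1 \<Longrightarrow> \<epsilon> k \<ge> 0"
    and "\<And>k. k \<ge> 1 \<Longrightarrow> eps_optimal (\<lambda>u. f (u, x k) + Q k u) Y (\<epsilon> k) (y k)"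
    and "\<epsilon> \<longlonglongrightarrow> 0"
  shows "(\<lambda>k. eta grad_y_f (Q k) Y (x k) (y k)) \<longlonglongrightarrow> 0"
proof -
  \<comment> \<open>The \<open>1\<close> keeps \<open>D\<close> positive when \<open>Y\<close> is a single point.\<close>
  define D where "D = diameter Y + 1"
  have "diameter Y \<ge> 0"
    using \<open>compact Y\<close> by (simp add: diameter_ge_0 compact_imp_bounded)
  then have "D > 0" by (simp add: D_def)
  have D: "norm (u - v) \<le> D" if "u \<in> Y" "v \<in> Y" for u v
    using diameter_bounded_bound[OF compact_imp_bounded[OF \<open>compact Y\<close>] that]
    by (simp add: D_def dist_norm)
  have K: "compact (Y \<times> X)" "convex (Y \<times> X)"
    using assms by (auto intro: compact_Times convex_Times)
  obtain G where G: "continuous_on (Y \<times> X) G"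
      "\<And>z. z \<in> Y \<times> X \<Longrightarrow> has_gradient_within f (G z) z (Y \<times> X)"
    using \<open>C1_on (Y \<times> X) f\<close> unfolding C1_on_def by blast
  have contf: "continuous_on (Y \<times> X) f"
    using G(2) has_derivative_continuous
    unfolding continuous_on_eq_continuous_within has_gradient_within_def by blast
  have contQ: "continuous_on Y (Q k)" if "k \<ge> 1" for k
    using assms(11)[OF that] by (rule lipschitz_on_continuous_on)
  have yY: "y k \<in> Y" if "k \<ge> 1" for k
    using assms(17)[OF that] by (simp add: eps_optimal_def)
  have bdd: "bdd_below ((\<lambda>u. f (u, x k) + Q k u) ` Y)" if "k \<ge> 1" for k
  proof -
    have "continuous_on Y (\<lambda>u. f (u, x k))"
      using assms(15)[OF that]
      by (intro continuous_on_compose2[OF contf] continuous_intros) auto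
    then have "continuous_on Y (\<lambda>u. f (u, x k) + Q k u)"
      using contQ[OF that] by (intro continuous_intros)
    then have "compact ((\<lambda>u. f (u, x k) + Q k u) ` Y)"
      using \<open>compact Y\<close> by (rule compact_continuous_image)
    then show ?thesis
      by (intro bounded_imp_bdd_below compact_imp_bounded)
  qed
  \<comment> \<open>Gradients relative to \<open>Y\<close> need not be unique, but they agree along directions within \<open>Y\<close>.\<close>
  have grad_eq: "grad_y_f (v, w) \<bullet> (v - u) = fst (G (v, w)) \<bullet> (v - u)"
    if "u \<in> Y" "v \<in> Y" "w \<in> X" for u v w
  proof (rule has_gradient_within_inner_unique[OF \<open>convex Y\<close> \<open>v \<in> Y\<close> \<open>u \<in> Y\<close>])
    show "has_gradient_within (\<lambda>u. f (u, w)) (grad_y_f (v, w)) v Y"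
      using assms(9) that by (simp add: partial_gradient_fst_on_def)
    show "has_gradient_within (\<lambda>u. f (u, w)) (fst (G (v, w))) v Y"
      using G(2) that by (intro has_gradient_within_fst[where X = X]) auto
  qed
  let ?gap = "\<lambda>k u. grad_y_f (y k, x k) \<bullet> (y k - u) + Q k (y k) - Q k u"
  have attained: "\<exists>u\<in>Y. eta grad_y_f (Q k) Y (x k) (y k) = ?gap k u \<and> 0 \<le> ?gap k u"
    if "k \<ge> 1" for k
  proof -
    have "continuous_on Y (?gap k)"
      using contQ[OF that] by (intro continuous_intros)
    from maximum_on_attained[OF \<open>compact Y\<close> \<open>Y \<noteq> {}\<close> this] obtain u where
      u: "u \<in> Y" "maximum_on (?gap k) Y = ?gap k u" "\<And>v. v \<in> Y \<Longrightarrow> ?gap k v \<le> ?gap k u"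
      by blast
    have "?gap k (y k) = 0" by simp
    with u(3)[OF yY[OF that]] have "0 \<le> ?gap k u" by linarith
    with u(1,2) show ?thesis unfolding eta_def by blast
  qed
  show ?thesis
  proof (rule LIMSEQ_I)
    fix e :: real assume "e > 0"
    \<comment> \<open>Half of \<open>e\<close> is left for the linearization error, half for the term \<open>\<epsilon> k / t\<close>.\<close>
    have "e / (2 * D) > 0" using \<open>e > 0\<close> \<open>D > 0\<close> by simp
    from C1_on_uniform_linearization[OF K G this] obtain d where "d > 0" and
      d: "\<And>z w. \<lbrakk>z \<in> Y \<times> X; w \<in> Y \<times> X; dist z w < d\<rbrakk>
        \<Longrightarrow> \<bar>f w - f z - G z \<bullet> (w - z)\<bar> \<le> e / (2 * D) * norm (w - z)"
      by blast
    define t where "t = min 1 (d / (2 * D))"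
    have t: "0 < t" "t \<le> 1" using \<open>d > 0\<close> \<open>D > 0\<close> by (auto simp: t_def)
    have "t * D \<le> d / (2 * D) * D"
      using \<open>D > 0\<close> by (intro mult_right_mono) (auto simp: t_def)
    then have tD: "t * D < d" using \<open>D > 0\<close> \<open>d > 0\<close> by simp
    have gap: "?gap k u \<le> \<epsilon> k / t + e / 2" if k: "k \<ge> 1" and u: "u \<in> Y" for k u
    proof -
      note yk = yY[OF k] and xk = assms(15)[OF k]
      let ?z = "y k + t *\<^sub>R (u - y k)"
      have "?z \<in> Y"
        using convexD_alt[OF \<open>convex Y\<close> yk u, of t] t by (simp add: algebra_simps)
      have n: "norm ((?z, x k) - (y k, x k)) = t * norm (u - y k)"
        using t by (simp add: norm_Pair)
      have le: "t * norm (u - y k) \<le> t * D" using D[OF u yk] t by simp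
      have "dist (?z, x k) (y k, x k) < d"
        unfolding dist_norm n using le tD by linarith
      then have "dist (y k, x k) (?z, x k) < d"
        by (subst dist_commute)
      then have "\<bar>f (?z, x k) - f (y k, x k) - G (y k, x k) \<bullet> ((?z, x k) - (y k, x k))\<bar>
          \<le> e / (2 * D) * (t * norm (u - y k))"
        using d[of "(y k, x k)" "(?z, x k)", unfolded n] yk xk \<open>?z \<in> Y\<close> by blast
      also have "\<dots> \<le> e / (2 * D) * (t * D)"
        using \<open>e / (2 * D) > 0\<close> by (intro mult_left_mono[OF le]) simp
      also have "\<dots> = t * (e / 2)" using \<open>D > 0\<close> by simp
      finally have lin: "\<bar>f (?z, x k) - f (y k, x k) - G (y k, x k) \<bullet> ((?z, x k) - (y k, x k))\<bar>
          \<le> t * (e / 2)" .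
      have "G (y k, x k) \<bullet> ((?z, x k) - (y k, x k)) = t * (fst (G (y k, x k)) \<bullet> (u - y k))"
        by (simp add: inner_prod_def)
      with lin have "f (?z, x k) \<le> f (y k, x k) + t * (fst (G (y k, x k)) \<bullet> (u - y k)) + t * (e / 2)"
        by linarith
      from linearized_gap_le[OF \<open>convex Y\<close> assms(10)[OF k] bdd[OF k] assms(17)[OF k] u t this]
      show ?thesis
        using grad_eq[OF u yk xk] by simp
    qed
    obtain N where N: "\<And>k. k \<ge> N \<Longrightarrow> norm (\<epsilon> k - 0) < t * (e / 2)"
      using LIMSEQ_D[OF \<open>\<epsilon> \<longlonglongrightarrow> 0\<close>, of "t * (e / 2)"] t \<open>e > 0\<close> by auto
    show "\<exists>N. \<forall>k\<ge>N. norm (eta grad_y_f (Q k) Y (x k) (y k) - 0) < e"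
    proof (intro exI allI impI)
      fix k assume "k \<ge> max 1 N"
      then have k: "k \<ge> 1" "k \<ge> N" by auto
      obtain u where u: "u \<in> Y" "eta grad_y_f (Q k) Y (x k) (y k) = ?gap k u" "0 \<le> ?gap k u"
        using attained[OF k(1)] by blast
      have "\<epsilon> k < t * (e / 2)" using N[OF k(2)] by simp
      then have "\<epsilon> k / t < e / 2" using t by (simp add: field_simps)
      with gap[OF k(1) u(1)] have "?gap k u < e" by linarith
      with u(2,3) show "norm (eta grad_y_f (Q k) Y (x k) (y k) - 0) < e" by simp
    qed
  qed
qed

end
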